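(* Let $(M,d)$ be a generalized metric space. Then: (i) The maps $d:M_C^+\times(M_C^+\cup M_C^-)\to[0,\infty]$ and $d^{\mathrm{rev}}:M_C^-\times(M_C^+\cup M_C^-)\to[0,\infty]$ given by the double limits $$d([\{x_n\}],[\{y_n\}])=\lim_n(\lim_md(x_n,y_m)),\qquad d^{\mathrm{rev}}([\{x_n\}],[\{y_n\}])=\lim_n(\lim_md^{\mathrm{rev}}(x_n,y_m))$$ are well-defined. (ii) $d(x,y)=d^{\mathrm{rev}}(y,x)$ for all $x\in M_C^+$, $y\in M_C^-$.
   Context: A generalized metric space $(M,d)$ is a set with a map $d:M\times M\to\mathbb R$ satisfying: $d\ge0$; $d(x,y)=d(y,x)=0$ iff $x=y$; $d(x,z)\le d(x,y)+d(y,z)$; and for any sequence $\{x_n\}$ and $x\in M$, $d(x_n,x)\to0$ iff $d(x,x_n)\to0$. $d^{\mathrm{rev}}(x,y)=d(y,x)$. $\{x_n\}$ is a forward Cauchy sequence if for all $\epsilon>0$ there is $n_0$ with $d(x_n,x_m)<\epsilon$ whenever $n_0\le n\le m$; two forward Cauchy sequences are equivalent if $\lim_n(\lim_md(x_n,x'_m))=\lim_n(\lim_md(x'_n,x_m))=0$. The forward Cauchy completion $M_C^+$ is the set of equivalence classes of forward Cauchy sequences, with $M$ regarded as the classes of convergent sequences, and $\partial_C^+M=M_C^+\setminus M$. The backward Cauchy completion $M_C^-$ and boundary $\partial_C^-M$ are the same objects for $d^{\mathrm{rev}}$. A point of $\partial_C^+M$ and a point of $\partial_C^-M$ are identified when they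 are represented by the same class of sequences; in $M_C^+\cup M_C^-$ the copies of $M$ and these boundary points are identified. In the double limits the sequences are forward (resp. backward) Cauchy representatives of points of $M_C^+$ (resp. $M_C^-$). *)

theory Defs
  imports "HOL-Analysis.Analysis"
begin

definition generalized_metric_space :: "'a set \<Rightarrow> ('a \<Rightarrow> 'a \<Rightarrow> real) \<Rightarrow> bool" where
  "generalized_metric_space M d \<longleftrightarrow>
     (\<forall>x\<in>M. \<forall>y\<in>M. 0 \<le> d x y) \<and>
     (\<forall>x\<in>M. \<forall>y\<in>M. d x y = 0 \<and> d y x = 0 \<longleftrightarrow> x = y) \<and>
     (\<forall>x\<in>M. \<forall>y\<in>M. \<forall>z\<in>M. d x z \<le> d x y + d y z) \<and>
     (\<forall>s x. range s \<subseteq> M \<longrightarrow> x \<in> M \<longrightarrow>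
        (\<lambda>n. d (s n) x) \<longlonglongrightarrow> 0 \<longleftrightarrow> (\<lambda>n. d x (s n)) \<longlonglongrightarrow> 0)"

definition drev :: "('a \<Rightarrow> 'a \<Rightarrow> real) \<Rightarrow> 'a \<Rightarrow> 'a \<Rightarrow> real" where
  "drev d x y = d y x"

definition forward_Cauchy :: "'a set \<Rightarrow> ('a \<Rightarrow> 'a \<Rightarrow> real) \<Rightarrow> (nat \<Rightarrow> 'a) \<Rightarrow> bool" where
  "forward_Cauchy M d s \<longleftrightarrow>
     range s \<subseteq> M \<and> (\<forall>e>0. \<exists>n0. \<forall>n m. n0 \<le> n \<and> n \<le> m \<longrightarrow> d (s n) (s m) < e)"

text \<open>
  The assertion that \<open>lim\<^sub>n (lim\<^sub>m f n m)\<close> exists in \<open>[0,\<infinity>]\<close>, all inner limits included, and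
  equals \<open>L\<close>. It is only used for nonnegative \<open>f\<close>, on which \<^const>\<open>ennreal\<close> is the inclusion of
  the nonnegative reals.
\<close>

definition has_iterated_limit :: "(nat \<Rightarrow> nat \<Rightarrow> real) \<Rightarrow> ennreal \<Rightarrow> bool" where
  "has_iterated_limit f L \<longleftrightarrow>
     (\<exists>l. (\<forall>n. (\<lambda>m. ennreal (f n m)) \<longlonglongrightarrow> l n) \<and> l \<longlonglongrightarrow> L)"

definition forward_equiv :: "'a set \<Rightarrow> ('a \<Rightarrow> 'a \<Rightarrow> real) \<Rightarrow> ((nat \<Rightarrow> 'a) \<times> (nat \<Rightarrow> 'a)) set" where
  "forward_equiv M d =
     {(s, t). forward_Cauchy M d s \<and> forward_Cauchy M d t \<and>
        has_iterated_limit (\<lambda>n m. d (s n) (t m)) 0 \<and>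
        has_iterated_limit (\<lambda>n m. d (t n) (s m)) 0}"

definition forward_completion :: "'a set \<Rightarrow> ('a \<Rightarrow> 'a \<Rightarrow> real) \<Rightarrow> (nat \<Rightarrow> 'a) set set" where
  "forward_completion M d = {s. forward_Cauchy M d s} // forward_equiv M d"

text \<open>
  Points of both completions are sets of sequences in \<open>M\<close>, so the union of the forward and
  the backward completion is a plain set union: a forward and a backward point are
  identified iff they are the same class of sequences. This includes the two copies of
  \<open>M\<close>, since the sequences converging to a given point of \<open>M\<close> form a class in both
  completions (see \<open>class_of_point\<close> and \<open>class_of_point_backward\<close> below).
\<close>

definition backward_completion :: "'a set \<Rightarrow> ('a \<Rightarrow> 'a \<Rightarrow> real) \<Rightarrow> (nat \<Rightarrow> 'a) set set" where
  "backward_completion M d = forward_completion M (drev d)"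

definition is_ext_dist ::
    "('a \<Rightarrow> 'a \<Rightarrow> real) \<Rightarrow> (nat \<Rightarrow> 'a) set \<Rightarrow> (nat \<Rightarrow> 'a) set \<Rightarrow> ennreal \<Rightarrow> bool" where
  "is_ext_dist d p q L \<longleftrightarrow>
     (\<forall>x\<in>p. \<forall>y\<in>q. has_iterated_limit (\<lambda>n m. d (x n) (y m)) L)"

text \<open>Meaningful only where exactly one \<open>L\<close> satisfies \<^term>\<open>is_ext_dist d p q L\<close>.\<close>

definition ext_dist ::
    "('a \<Rightarrow> 'a \<Rightarrow> real) \<Rightarrow> (nat \<Rightarrow> 'a) set \<Rightarrow> (nat \<Rightarrow> 'a) set \<Rightarrow> ennreal" where
  "ext_dist d p q = (THE L. is_ext_dist d p q L)"

lemma generalized_metric_spaceD: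
  assumes "generalized_metric_space M d"
  shows "x \<in> M \<Longrightarrow> y \<in> M \<Longrightarrow> 0 \<le> d x y"
    and "x \<in> M \<Longrightarrow> d x x = 0"
    and "x \<in> M \<Longrightarrow> y \<in> M \<Longrightarrow> z \<in> M \<Longrightarrow> d x z \<le> d x y + d y z"
    and "range s \<subseteq> M \<Longrightarrow> x \<in> M \<Longrightarrow> (\<lambda>n. d (s n) x) \<longlonglongrightarrow> 0 \<longleftrightarrow> (\<lambda>n. d x (s n)) \<longlonglongrightarrow> 0"
proof -
  note A = assms[unfolded generalized_metric_space_def]
  show "x \<in> M \<Longrightarrow> y \<in> M \<Longrightarrow> 0 \<le> d x y"
    by (rule A[THEN conjunct1, rule_format])
  show "x \<in> M \<Longrightarrow> d x x = 0"
    using A[THEN conjunct2, THEN conjunct1, rule_format, of x x] by simp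
  show "x \<in> M \<Longrightarrow> y \<in> M \<Longrightarrow> z \<in> M \<Longrightarrow> d x z \<le> d x y + d y z"
    by (rule A[THEN conjunct2, THEN conjunct2, THEN conjunct1, rule_format])
  show "range s \<subseteq> M \<Longrightarrow> x \<in> M \<Longrightarrow> (\<lambda>n. d (s n) x) \<longlonglongrightarrow> 0 \<longleftrightarrow> (\<lambda>n. d x (s n)) \<longlonglongrightarrow> 0"
    by (rule A[THEN conjunct2, THEN conjunct2, THEN conjunct2, rule_format])
qed

lemma forward_CauchyD:
  "forward_Cauchy M d s \<Longrightarrow> 0 < e \<Longrightarrow>
    \<exists>n0. \<forall>n m. n0 \<le> n \<and> n \<le> m \<longrightarrow> d (s n) (s m) < e"
  unfolding forward_Cauchy_def by simp

lemma generalized_metric_space_drev: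
  assumes gms: "generalized_metric_space M d"
  shows "generalized_metric_space M (drev d)"
  unfolding generalized_metric_space_def drev_def
proof (intro conjI ballI allI impI)
  note D = generalized_metric_spaceD[OF gms]
  show "0 \<le> d y x" if "x \<in> M" "y \<in> M" for x y using D(1) that by simp
  show "d y x = 0 \<and> d x y = 0 \<longleftrightarrow> x = y" if "x \<in> M" "y \<in> M" for x y
    using gms[unfolded generalized_metric_space_def, THEN conjunct2, THEN conjunct1, rule_format, OF that]
    by (simp add: conj_commute)
  show "d z x \<le> d y x + d z y" if "x \<in> M" "y \<in> M" "z \<in> M" for x y z
    using D(3)[OF that(3,2,1)] by simp
  show "(\<lambda>n. d x (s n)) \<longlonglongrightarrow> 0 \<longleftrightarrow> (\<lambda>n. d (s n) x) \<longlonglongrightarrow> 0" if "range s \<subseteq> M" "x \<in> M" for s x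
    by (rule D(4)[OF that, symmetric])
qed

lemma almost_decreasing_convergent:
  fixes a :: "nat \<Rightarrow> ennreal"
  assumes "\<And>e::real. 0 < e \<Longrightarrow> \<exists>n0. \<forall>n m. n0 \<le> n \<and> n \<le> m \<longrightarrow> a m \<le> a n + ennreal e"
  shows "\<exists>l. a \<longlonglongrightarrow> l"
proof -
  have "limsup a \<le> liminf a"
  proof (rule ennreal_le_epsilon)
    fix e :: real assume "0 < e"
    then obtain n0 where n0: "\<And>n m. n0 \<le> n \<Longrightarrow> n \<le> m \<Longrightarrow> a m \<le> a n + ennreal e"
      using assms by blast
    have "limsup a \<le> a n + ennreal e" if "n0 \<le> n" for n
      by (rule Limsup_bounded) (use n0 that in \<open>auto simp: eventually_sequentially\<close>)
    then have "limsup a - ennreal e \<le> a n" if "n0 \<le> n" for n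
      using that by (simp add: ennreal_minus_le_iff add.commute)
    then have "limsup a - ennreal e \<le> liminf a"
      by (intro Liminf_bounded) (auto simp: eventually_sequentially)
    then show "limsup a \<le> liminf a + ennreal e"
      by (simp add: ennreal_minus_le_iff add.commute)
  qed
  moreover have "liminf a \<le> limsup a"
    by (rule Liminf_le_Limsup) simp
  ultimately have "liminf a = limsup a" by simp
  then have "a \<longlonglongrightarrow> limsup a"
    by (simp add: tendsto_iff_Liminf_eq_Limsup)
  then show ?thesis by blast
qed

lemma forward_limit_exists:
  assumes "generalized_metric_space M d" "forward_Cauchy M d s" "x \<in> M"
  shows "\<exists>l. (\<lambda>m. ennreal (d x (s m))) \<longlonglongrightarrow> l"
proof (rule almost_decreasing_convergent)
  note D = generalized_metric_spaceD[OF assms(1)]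
  have s: "s n \<in> M" for n using assms(2) by (auto simp: forward_Cauchy_def)
  fix e :: real assume "0 < e"
  obtain n0 where n0: "\<forall>n m. n0 \<le> n \<and> n \<le> m \<longrightarrow> d (s n) (s m) < e"
    using forward_CauchyD[OF assms(2) \<open>0 < e\<close>] ..
  have "ennreal (d x (s m)) \<le> ennreal (d x (s n)) + ennreal e" if "n0 \<le> n" "n \<le> m" for n m
  proof -
    have "d x (s m) \<le> d x (s n) + e"
      using D(3)[OF assms(3) s s, of m n] n0[rule_format, of n m] that by simp
    then show ?thesis
      using \<open>0 < e\<close> D(1)[OF assms(3) s] by (simp add: ennreal_plus[symmetric] ennreal_leI del: ennreal_plus)
  qed
  then show "\<exists>n0. \<forall>n m. n0 \<le> n \<and> n \<le> m \<longrightarrow>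
      ennreal (d x (s m)) \<le> ennreal (d x (s n)) + ennreal e"
    by (intro exI[of _ n0]) simp
qed

lemma has_iterated_limit_trans:
  assumes gms: "generalized_metric_space M d"
    and x: "range x \<subseteq> M" and y: "range y \<subseteq> M" and z: "forward_Cauchy M d z"
    and xy: "has_iterated_limit (\<lambda>n m. d (x n) (y m)) 0"
    and yz: "has_iterated_limit (\<lambda>n m. d (y n) (z m)) 0"
  shows "has_iterated_limit (\<lambda>n m. d (x n) (z m)) 0"
proof -
  note D = generalized_metric_spaceD[OF gms]
  have mem: "x n \<in> M" "y n \<in> M" "z n \<in> M" for n
    using x y z by (auto simp: forward_Cauchy_def)
  obtain a where a: "\<And>n. (\<lambda>m. ennreal (d (x n) (y m))) \<longlonglongrightarrow> a n" "a \<longlonglongrightarrow> 0"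
    using xy unfolding has_iterated_limit_def by blast
  obtain b where b: "\<And>n. (\<lambda>m. ennreal (d (y n) (z m))) \<longlonglongrightarrow> b n" "b \<longlonglongrightarrow> 0"
    using yz unfolding has_iterated_limit_def by blast
  obtain l where l: "\<And>n. (\<lambda>m. ennreal (d (x n) (z m))) \<longlonglongrightarrow> l n"
    using forward_limit_exists[OF gms z mem(1)] by metis
  have 1: "l n \<le> ennreal (d (x n) (y k)) + b k" for n k
  proof (rule LIMSEQ_le[OF l tendsto_add[OF tendsto_const b(1)]], intro exI allI impI)
    fix m
    show "ennreal (d (x n) (z m)) \<le> ennreal (d (x n) (y k)) + ennreal (d (y k) (z m))"
      using D(3)[OF mem(1) mem(2) mem(3)] D(1) mem
      by (simp add: ennreal_plus[symmetric] ennreal_leI del: ennreal_plus)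
  qed
  have "l n \<le> a n" for n
    using LIMSEQ_le_const[OF tendsto_add[OF a(1) b(2)]] 1 by simp
  then have "l \<longlonglongrightarrow> 0"
    by (intro tendsto_sandwich[OF _ _ tendsto_const a(2)]) auto
  with l show ?thesis unfolding has_iterated_limit_def by blast
qed

lemma has_iterated_limit_refl:
  assumes gms: "generalized_metric_space M d" and s: "forward_Cauchy M d s"
  shows "has_iterated_limit (\<lambda>n m. d (s n) (s m)) 0"
proof -
  have mem: "s n \<in> M" for n using s by (auto simp: forward_Cauchy_def)
  obtain l where l: "\<And>n. (\<lambda>m. ennreal (d (s n) (s m))) \<longlonglongrightarrow> l n"
    using forward_limit_exists[OF gms s mem] by metis
  have "l \<longlonglongrightarrow> 0"
    unfolding order_tendsto_iff
  proof (intro conjI allI impI)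
    fix u :: ennreal assume "0 < u"
    then obtain e where e: "0 < ennreal e" "ennreal e < u"
      using dense[of 0 u] by (metis ennreal_cases infinity_ennreal_def not_top_less top.not_eq_extremum)
    then have "0 < e" by simp
    obtain n0 where n0: "\<forall>n m. n0 \<le> n \<and> n \<le> m \<longrightarrow> d (s n) (s m) < e"
      using forward_CauchyD[OF s \<open>0 < e\<close>] ..
    have "l n \<le> ennreal e" if "n0 \<le> n" for n
      using n0 that by (intro LIMSEQ_le_const2[OF l] exI[of _ n] allI impI ennreal_leI less_imp_le) simp_all
    then show "\<forall>\<^sub>F n in sequentially. l n < u"
      using e(2) unfolding eventually_sequentially by (meson le_less_trans)
  qed auto
  with l show ?thesis unfolding has_iterated_limit_def by blast
qed

lemma equiv_forward_equiv:
  assumes "generalized_metric_space M d"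
  shows "equiv {s. forward_Cauchy M d s} (forward_equiv M d)"
proof (rule equivI)
  show "forward_equiv M d \<subseteq> {s. forward_Cauchy M d s} \<times> {s. forward_Cauchy M d s}"
    by (auto simp: forward_equiv_def)
  show "refl_on {s. forward_Cauchy M d s} (forward_equiv M d)"
    using has_iterated_limit_refl[OF assms] by (auto simp: refl_on_def forward_equiv_def)
  show "sym (forward_equiv M d)"
    by (auto simp: sym_def forward_equiv_def)
  show "trans (forward_equiv M d)"
  proof (rule transI)
    fix x y z assume "(x, y) \<in> forward_equiv M d" "(y, z) \<in> forward_equiv M d"
    then show "(x, z) \<in> forward_equiv M d"
      unfolding forward_equiv_def
      using has_iterated_limit_trans[OF assms, of x y z] has_iterated_limit_trans[OF assms, of z y x]
      by (auto simp: forward_Cauchy_def)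
  qed
qed

lemma convergent_imp_forward_Cauchy:
  assumes gms: "generalized_metric_space M d" and "range s \<subseteq> M" "x \<in> M" "(\<lambda>n. d (s n) x) \<longlonglongrightarrow> 0"
  shows "forward_Cauchy M d s"
  unfolding forward_Cauchy_def
proof (intro conjI allI impI)
  note D = generalized_metric_spaceD[OF gms]
  have rev: "(\<lambda>n. d x (s n)) \<longlonglongrightarrow> 0"
    using D(4) assms by blast
  fix e :: real assume "0 < e"
  then have e: "0 < e / 2" by simp
  have "\<forall>\<^sub>F n in sequentially. d (s n) x < e / 2 \<and> d x (s n) < e / 2"
    using order_tendstoD(2)[OF assms(4) e] order_tendstoD(2)[OF rev e] by (rule eventually_conj)
  then obtain n0 where n0: "\<And>n. n0 \<le> n \<Longrightarrow> d (s n) x < e / 2 \<and> d x (s n) < e / 2"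
    unfolding eventually_sequentially by blast
  have "d (s n) (s m) < e" if "n0 \<le> n" "n \<le> m" for n m
    using D(3)[of "s n" x "s m"] n0[of n] n0[of m] that assms(2,3) by fastforce
  then show "\<exists>n0. \<forall>n m. n0 \<le> n \<and> n \<le> m \<longrightarrow> d (s n) (s m) < e" by blast
qed (use assms in simp)

lemma has_iterated_limit_const_right:
  assumes "\<And>n. 0 \<le> f n"
  shows "has_iterated_limit (\<lambda>n m. f n) 0 \<longleftrightarrow> f \<longlonglongrightarrow> 0"
proof
  assume "has_iterated_limit (\<lambda>n m. f n) 0"
  then obtain l where l: "\<And>n. (\<lambda>m::nat. ennreal (f n)) \<longlonglongrightarrow> l n" "l \<longlonglongrightarrow> 0"
    unfolding has_iterated_limit_def by blast
  have "l = (\<lambda>n. ennreal (f n))"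
    using LIMSEQ_unique[OF l(1) tendsto_const] by blast
  then show "f \<longlonglongrightarrow> 0"
    using l(2) assms by (simp flip: ennreal_0)
next
  assume "f \<longlonglongrightarrow> 0"
  then have "(\<lambda>n. ennreal (f n)) \<longlonglongrightarrow> 0"
    using tendsto_ennrealI by fastforce
  then show "has_iterated_limit (\<lambda>n m. f n) 0"
    unfolding has_iterated_limit_def by (intro exI[of _ "\<lambda>n. ennreal (f n)"]) auto
qed

lemma has_iterated_limit_const_left:
  assumes "f \<longlonglongrightarrow> 0"
  shows "has_iterated_limit (\<lambda>n m. f m) 0"
  using tendsto_ennrealI[OF assms] unfolding has_iterated_limit_def
  by (intro exI[of _ "\<lambda>n. 0"]) auto

lemma class_of_point:
  assumes gms: "generalized_metric_space M d" and x: "x \<in> M"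
  shows "forward_equiv M d `` {\<lambda>_. x} = {s. range s \<subseteq> M \<and> (\<lambda>n. d (s n) x) \<longlonglongrightarrow> 0}"
proof -
  note D = generalized_metric_spaceD[OF gms]
  have const: "forward_Cauchy M d (\<lambda>_. x)"
    using convergent_imp_forward_Cauchy[OF gms _ x, of "\<lambda>_. x"] x D(2) by auto
  have "(\<lambda>_. x, s) \<in> forward_equiv M d \<longleftrightarrow> range s \<subseteq> M \<and> (\<lambda>n. d (s n) x) \<longlonglongrightarrow> 0" for s
  proof
    assume "(\<lambda>_. x, s) \<in> forward_equiv M d"
    then have s: "range s \<subseteq> M" "has_iterated_limit (\<lambda>n m. d (s n) x) 0"
      by (auto simp: forward_equiv_def forward_Cauchy_def)
    have "\<And>n. 0 \<le> d (s n) x" using D(1)[OF range_subsetD[OF s(1)] x] by simp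
    then show "range s \<subseteq> M \<and> (\<lambda>n. d (s n) x) \<longlonglongrightarrow> 0"
      using s by (simp add: has_iterated_limit_const_right)
  next
    assume s: "range s \<subseteq> M \<and> (\<lambda>n. d (s n) x) \<longlonglongrightarrow> 0"
    then have sM: "range s \<subseteq> M" and lim: "(\<lambda>n. d (s n) x) \<longlonglongrightarrow> 0" by simp_all
    have pos: "0 \<le> d (s n) x" for n
      by (rule D(1)[OF range_subsetD[OF sM] x])
    have rev: "(\<lambda>n. d x (s n)) \<longlonglongrightarrow> 0"
      by (rule D(4)[OF sM x, THEN iffD1, OF lim])
    have "forward_Cauchy M d s"
      by (rule convergent_imp_forward_Cauchy[OF gms sM x lim])
    then show "(\<lambda>_. x, s) \<in> forward_equiv M d"
      using const s has_iterated_limit_const_left[OF rev]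
      by (simp add: forward_equiv_def has_iterated_limit_const_right[OF pos])
  qed
  then show ?thesis by (simp add: set_eq_iff)
qed

lemma class_of_point_backward:
  assumes gms: "generalized_metric_space M d" and x: "x \<in> M"
  shows "forward_equiv M (drev d) `` {\<lambda>_. x} = forward_equiv M d `` {\<lambda>_. x}"
proof -
  have "range s \<subseteq> M \<and> (\<lambda>n. drev d (s n) x) \<longlonglongrightarrow> 0 \<longleftrightarrow>
      range s \<subseteq> M \<and> (\<lambda>n. d (s n) x) \<longlonglongrightarrow> 0" for s
    unfolding drev_def
    by (rule conj_cong[OF refl]) (rule generalized_metric_spaceD(4)[OF gms _ x, symmetric])
  then show ?thesis
    unfolding class_of_point[OF gms x]
      class_of_point[OF generalized_metric_space_drev[OF gms] x] by simp
qed

end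

theory Submission
  imports Defs
begin

text \<open>
  For a forward or backward Cauchy sequence \<open>y\<close>, the triangle inequality makes \<open>d u (y m)\<close> monotone
  in \<open>m\<close> up to an arbitrarily small error, so it converges in \<open>[0,\<infinity>]\<close>; its limit depends only on
  the class of \<open>y\<close> and is 1-Lipschitz in \<open>u\<close>. Any 1-Lipschitz function \<open>\<phi>\<close> is in turn almost
  increasing along a forward Cauchy sequence \<open>x\<close>, so \<open>\<phi> (x n)\<close> converges, to a limit depending
  only on the class of \<open>x\<close>. For the symmetry, \<open>d (x n) (y m)\<close> is almost increasing in both indices
  when \<open>x\<close> is forward and \<open>y\<close> backward Cauchy, so the two iterated limits agree, as suprema would.
\<close>

lemma drev_drev [simp]: "drev (drev d) = d"
  by (simp add: drev_def fun_eq_iff)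

lemma almost_increasing_convergent:
  fixes a :: "nat \<Rightarrow> ennreal"
  assumes "\<And>e::real. 0 < e \<Longrightarrow> \<exists>n0. \<forall>n m. n0 \<le> n \<and> n \<le> m \<longrightarrow> a n \<le> a m + ennreal e"
  shows "\<exists>l. a \<longlonglongrightarrow> l"
proof -
  have "limsup a \<le> liminf a"
  proof (rule ennreal_le_epsilon)
    fix e :: real assume "0 < e"
    then obtain n0 where n0: "\<And>n m. n0 \<le> n \<Longrightarrow> n \<le> m \<Longrightarrow> a n \<le> a m + ennreal e"
      using assms by blast
    have "a n - ennreal e \<le> liminf a" if "n0 \<le> n" for n
      by (rule Liminf_bounded)
        (use n0 that in \<open>auto simp: eventually_sequentially ennreal_minus_le_iff add.commute\<close>)
    then have "a n \<le> liminf a + ennreal e" if "n0 \<le> n" for n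
      using that by (simp add: ennreal_minus_le_iff add.commute)
    then show "limsup a \<le> liminf a + ennreal e"
      by (intro Limsup_bounded) (auto simp: eventually_sequentially)
  qed
  moreover have "liminf a \<le> limsup a"
    by (rule Liminf_le_Limsup) simp
  ultimately have "a \<longlonglongrightarrow> limsup a"
    by (simp add: tendsto_iff_Liminf_eq_Limsup)
  then show ?thesis by blast
qed

lemma ennreal_triangle:
  assumes "generalized_metric_space M d" "x \<in> M" "y \<in> M" "z \<in> M"
  shows "ennreal (d x z) \<le> ennreal (d x y) + ennreal (d y z)"
  using generalized_metric_spaceD(1,3)[OF assms(1)] assms(2-)
  by (simp add: ennreal_leI flip: ennreal_plus)

lemma forward_Cauchy_ennreal:
  assumes "forward_Cauchy M d s" "0 < e"
  obtains n0 where "\<And>n m. n0 \<le> n \<Longrightarrow> n \<le> m \<Longrightarrow> ennreal (d (s n) (s m)) \<le> ennreal e"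
  using forward_CauchyD[OF assms] by (meson ennreal_leI less_imp_le)

lemma forward_Cauchy_mem: "forward_Cauchy M d s \<Longrightarrow> s n \<in> M"
  by (auto simp: forward_Cauchy_def)

lemma backward_limit_exists:
  assumes gms: "generalized_metric_space M d" and s: "forward_Cauchy M (drev d) s" and u: "u \<in> M"
  shows "\<exists>l. (\<lambda>m. ennreal (d u (s m))) \<longlonglongrightarrow> l"
proof (rule almost_increasing_convergent)
  fix e :: real assume "0 < e"
  obtain n0 where n0: "\<And>n m. n0 \<le> n \<Longrightarrow> n \<le> m \<Longrightarrow> ennreal (d (s m) (s n)) \<le> ennreal e"
    using forward_Cauchy_ennreal[OF s \<open>0 < e\<close>] by (auto simp: drev_def)
  note tri = ennreal_triangle[OF gms u forward_Cauchy_mem[OF s] forward_Cauchy_mem[OF s]]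
  have "ennreal (d u (s n)) \<le> ennreal (d u (s m)) + ennreal e" if "n0 \<le> n" "n \<le> m" for n m
    using order_trans[OF tri add_left_mono[OF n0[OF that]]] .
  then show "\<exists>n0. \<forall>n m. n0 \<le> n \<and> n \<le> m \<longrightarrow>
      ennreal (d u (s n)) \<le> ennreal (d u (s m)) + ennreal e"
    by blast
qed

lemma limit_le_of_iterated_limit_zero:
  assumes gms: "generalized_metric_space M d"
    and mem: "u \<in> M" "range y \<subseteq> M" "range z \<subseteq> M"
    and yz: "has_iterated_limit (\<lambda>n m. d (y n) (z m)) 0"
    and y: "(\<lambda>m. ennreal (d u (y m))) \<longlonglongrightarrow> \<alpha>" and z: "(\<lambda>m. ennreal (d u (z m))) \<longlonglongrightarrow> \<beta>"
  shows "\<beta> \<le> \<alpha>"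
proof -
  obtain b where b: "\<And>n. (\<lambda>m. ennreal (d (y n) (z m))) \<longlonglongrightarrow> b n" "b \<longlonglongrightarrow> 0"
    using yz unfolding has_iterated_limit_def by blast
  have "\<beta> \<le> ennreal (d u (y n)) + b n" for n
    by (rule LIMSEQ_le[OF z tendsto_add[OF tendsto_const b(1)]])
      (use ennreal_triangle[OF gms] mem in blast)
  then show ?thesis
    using LIMSEQ_le_const[OF tendsto_add[OF y b(2)]] by simp
qed

lemma limit_le_of_reverse_iterated_limit_zero:
  assumes gms: "generalized_metric_space M d"
    and mem: "u \<in> M" "range y \<subseteq> M" "range z \<subseteq> M"
    and yz: "has_iterated_limit (\<lambda>n m. drev d (y n) (z m)) 0"
    and y: "(\<lambda>m. ennreal (d u (y m))) \<longlonglongrightarrow> \<alpha>" and z: "(\<lambda>m. ennreal (d u (z m))) \<longlonglongrightarrow> \<beta>"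
  shows "\<alpha> \<le> \<beta>"
proof -
  obtain b where b: "\<And>n. (\<lambda>m. ennreal (d (z m) (y n))) \<longlonglongrightarrow> b n" "b \<longlonglongrightarrow> 0"
    using yz unfolding has_iterated_limit_def drev_def by blast
  have "ennreal (d u (y n)) \<le> \<beta> + b n" for n
    by (rule LIMSEQ_le_const[OF tendsto_add[OF z b(1)]])
      (use ennreal_triangle[OF gms] mem in blast)
  then show ?thesis
    using LIMSEQ_le[OF y tendsto_add[OF tendsto_const b(2)]] by simp
qed

lemma forward_completion_nonempty:
  assumes "generalized_metric_space M d" "p \<in> forward_completion M d"
  shows "p \<noteq> {}"
  using in_quotient_imp_non_empty[OF equiv_forward_equiv[OF assms(1)]] assms(2)
  by (simp add: forward_completion_def)

lemma forward_completion_equiv: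
  assumes "generalized_metric_space M d" "p \<in> forward_completion M d" "x \<in> p" "y \<in> p"
  shows "(x, y) \<in> forward_equiv M d"
  using quotient_eq_iff[OF equiv_forward_equiv[OF assms(1)], of p p x y] assms(2-)
  by (simp add: forward_completion_def)

lemma forward_completion_Cauchy:
  assumes "generalized_metric_space M d" "p \<in> forward_completion M d" "x \<in> p"
  shows "forward_Cauchy M d x"
  using forward_completion_equiv[OF assms(1,2,3,3)] by (simp add: forward_equiv_def)

lemma point_limit_unique:
  assumes gms: "generalized_metric_space M d" and u: "u \<in> M"
    and q: "q \<in> forward_completion M d \<union> backward_completion M d" and mem: "y \<in> q" "z \<in> q"
    and y: "(\<lambda>m. ennreal (d u (y m))) \<longlonglongrightarrow> \<alpha>" and z: "(\<lambda>m. ennreal (d u (z m))) \<longlonglongrightarrow> \<beta>"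
  shows "\<alpha> = \<beta>"
  using q
proof
  assume "q \<in> forward_completion M d"
  note E = forward_completion_equiv[OF gms this]
  have "(y, z) \<in> forward_equiv M d" using E mem by blast
  then show ?thesis
    using limit_le_of_iterated_limit_zero[OF gms u _ _ _ y z]
      limit_le_of_iterated_limit_zero[OF gms u _ _ _ z y]
    by (auto simp: forward_equiv_def forward_Cauchy_def)
next
  assume "q \<in> backward_completion M d"
  note E = forward_completion_equiv[OF generalized_metric_space_drev[OF gms]
      this[unfolded backward_completion_def]]
  have "(y, z) \<in> forward_equiv M (drev d)" using E mem by blast
  then show ?thesis
    using limit_le_of_reverse_iterated_limit_zero[OF gms u _ _ _ y z]
      limit_le_of_reverse_iterated_limit_zero[OF gms u _ _ _ z y]
    by (auto simp: forward_equiv_def forward_Cauchy_def)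
qed

lemma completion_range:
  assumes gms: "generalized_metric_space M d"
    and q: "q \<in> forward_completion M d \<union> backward_completion M d" and "y \<in> q"
  shows "y n \<in> M"
  using assms forward_completion_Cauchy[OF gms] forward_Cauchy_mem
    forward_completion_Cauchy[OF generalized_metric_space_drev[OF gms]]
  unfolding backward_completion_def by blast

lemma completion_nonempty:
  assumes gms: "generalized_metric_space M d"
    and q: "q \<in> forward_completion M d \<union> backward_completion M d"
  shows "q \<noteq> {}"
  using q forward_completion_nonempty[OF gms]
    forward_completion_nonempty[OF generalized_metric_space_drev[OF gms]]
  unfolding backward_completion_def by blast

lemma point_limit_exists:
  assumes gms: "generalized_metric_space M d"
    and q: "q \<in> forward_completion M d \<union> backward_completion M d"
  obtains \<phi> where "\<And>u y. u \<in> M \<Longrightarrow> y \<in> q \<Longrightarrow> (\<lambda>m. ennreal (d u (y m))) \<longlonglongrightarrow> \<phi> u"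
proof -
  have ex: "\<exists>l. (\<lambda>m. ennreal (d u (y m))) \<longlonglongrightarrow> l" if "u \<in> M" "y \<in> q" for u y
    using q that forward_limit_exists[OF gms forward_completion_Cauchy[OF gms]]
      backward_limit_exists[OF gms forward_completion_Cauchy[OF generalized_metric_space_drev[OF gms]]]
    unfolding backward_completion_def by blast
  obtain y0 where y0: "y0 \<in> q" using completion_nonempty[OF gms q] by blast
  obtain \<phi> where \<phi>: "\<And>u. u \<in> M \<Longrightarrow> (\<lambda>m. ennreal (d u (y0 m))) \<longlonglongrightarrow> \<phi> u"
    using ex[OF _ y0] by metis
  have "(\<lambda>m. ennreal (d u (y m))) \<longlonglongrightarrow> \<phi> u" if "u \<in> M" "y \<in> q" for u y
    using ex[OF that] point_limit_unique[OF gms that(1) q that(2) y0 _ \<phi>[OF that(1)]] by blast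
  then show thesis by (rule that)
qed

lemma lipschitz_limit_exists:
  fixes \<phi> :: "'a \<Rightarrow> ennreal"
  assumes x: "forward_Cauchy M d x"
    and lip: "\<And>u v. u \<in> M \<Longrightarrow> v \<in> M \<Longrightarrow> \<phi> u \<le> ennreal (d u v) + \<phi> v"
  shows "\<exists>L. (\<lambda>n. \<phi> (x n)) \<longlonglongrightarrow> L"
proof (rule almost_increasing_convergent)
  fix e :: real assume "0 < e"
  obtain n0 where n0: "\<And>n m. n0 \<le> n \<Longrightarrow> n \<le> m \<Longrightarrow> ennreal (d (x n) (x m)) \<le> ennreal e"
    using forward_Cauchy_ennreal[OF x \<open>0 < e\<close>] by blast
  have "\<phi> (x n) \<le> \<phi> (x m) + ennreal e" if "n0 \<le> n" "n \<le> m" for n m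
    using order_trans[OF lip add_right_mono[OF n0[OF that]]] forward_Cauchy_mem[OF x]
    by (simp add: add.commute)
  then show "\<exists>n0. \<forall>n m. n0 \<le> n \<and> n \<le> m \<longrightarrow> \<phi> (x n) \<le> \<phi> (x m) + ennreal e"
    by blast
qed

lemma lipschitz_limit_le:
  fixes \<phi> :: "'a \<Rightarrow> ennreal"
  assumes mem: "range x \<subseteq> M" "range x' \<subseteq> M"
    and xx: "has_iterated_limit (\<lambda>n m. d (x' n) (x m)) 0"
    and lip: "\<And>u v. u \<in> M \<Longrightarrow> v \<in> M \<Longrightarrow> \<phi> u \<le> ennreal (d u v) + \<phi> v"
    and L: "(\<lambda>n. \<phi> (x n)) \<longlonglongrightarrow> L" and L': "(\<lambda>n. \<phi> (x' n)) \<longlonglongrightarrow> L'"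
  shows "L' \<le> L"
proof -
  obtain a where a: "\<And>n. (\<lambda>m. ennreal (d (x' n) (x m))) \<longlonglongrightarrow> a n" "a \<longlonglongrightarrow> 0"
    using xx unfolding has_iterated_limit_def by blast
  have "\<phi> (x' n) \<le> a n + L" for n
    by (rule LIMSEQ_le_const[OF tendsto_add[OF a(1) L]]) (use lip mem in blast)
  then show ?thesis
    using LIMSEQ_le[OF L' tendsto_add[OF a(2) tendsto_const]] by simp
qed

lemma ex1_ext_dist:
  assumes gms: "generalized_metric_space M d" and p: "p \<in> forward_completion M d"
    and q: "q \<in> forward_completion M d \<union> backward_completion M d"
  shows "\<exists>!L. is_ext_dist d p q L"
proof -
  obtain \<phi> where \<phi>: "\<And>u y. u \<in> M \<Longrightarrow> y \<in> q \<Longrightarrow> (\<lambda>m. ennreal (d u (y m))) \<longlonglongrightarrow> \<phi> u"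
    using point_limit_exists[OF gms q] by blast
  obtain x0 y0 where x0: "x0 \<in> p" and y0: "y0 \<in> q"
    using forward_completion_nonempty[OF gms p] completion_nonempty[OF gms q] by blast
  note pC = forward_completion_Cauchy[OF gms p]
  note pM = forward_Cauchy_mem[OF pC]
  have lip: "\<phi> u \<le> ennreal (d u v) + \<phi> v" if "u \<in> M" "v \<in> M" for u v
    by (rule LIMSEQ_le[OF \<phi>[OF that(1) y0] tendsto_add[OF tendsto_const \<phi>[OF that(2) y0]]])
      (use ennreal_triangle[OF gms that completion_range[OF gms q y0]] in blast)
  obtain L where L: "(\<lambda>n. \<phi> (x0 n)) \<longlonglongrightarrow> L"
    using lipschitz_limit_exists[OF pC[OF x0], of \<phi>] lip by blast
  have lim: "(\<lambda>n. \<phi> (x n)) \<longlonglongrightarrow> L" if x: "x \<in> p" for x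
  proof -
    obtain K where K: "(\<lambda>n. \<phi> (x n)) \<longlonglongrightarrow> K"
      using lipschitz_limit_exists[OF pC[OF x], of \<phi>] lip by blast
    have r: "range x0 \<subseteq> M" "range x \<subseteq> M" using pM x x0 by auto
    have "has_iterated_limit (\<lambda>n m. d (x n) (x0 m)) 0" "has_iterated_limit (\<lambda>n m. d (x0 n) (x m)) 0"
      using forward_completion_equiv[OF gms p x x0] by (auto simp: forward_equiv_def)
    then have "K = L"
      using lipschitz_limit_le[OF r _ lip L K] lipschitz_limit_le[OF r(2,1) _ lip K L] by fastforce
    with K show ?thesis by simp
  qed
  have "has_iterated_limit (\<lambda>n m. d (x n) (y m)) L" if "x \<in> p" "y \<in> q" for x y
    unfolding has_iterated_limit_def
    using \<phi>[OF pM[OF that(1)] that(2)] lim[OF that(1)]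
    by (intro exI[of _ "\<lambda>n. \<phi> (x n)"]) simp
  then have ex: "is_ext_dist d p q L" by (simp add: is_ext_dist_def)
  moreover have "K = L" if "is_ext_dist d p q K" for K
  proof -
    obtain l where l: "\<And>n. (\<lambda>m. ennreal (d (x0 n) (y0 m))) \<longlonglongrightarrow> l n" "l \<longlonglongrightarrow> K"
      using \<open>is_ext_dist d p q K\<close> x0 y0 unfolding is_ext_dist_def has_iterated_limit_def by blast
    have "l = (\<lambda>n. \<phi> (x0 n))"
      using LIMSEQ_unique[OF l(1) \<phi>[OF pM[OF x0] y0]] by blast
    then show ?thesis using LIMSEQ_unique[OF l(2)] L by blast
  qed
  ultimately show ?thesis by blast
qed

lemma is_ext_dist_ext_dist:
  assumes "generalized_metric_space M d" "p \<in> forward_completion M d"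
    and "q \<in> forward_completion M d \<union> backward_completion M d"
  shows "is_ext_dist d p q (ext_dist d p q)"
  unfolding ext_dist_def by (rule theI'[OF ex1_ext_dist[OF assms]])

lemma iterated_limit_swap_le:
  assumes gms: "generalized_metric_space M d"
    and x: "forward_Cauchy M d x" and y: "forward_Cauchy M (drev d) y"
    and L: "has_iterated_limit (\<lambda>n m. d (x n) (y m)) L"
    and R: "has_iterated_limit (\<lambda>n m. d (x m) (y n)) R"
  shows "L \<le> R"
proof (rule ennreal_le_epsilon)
  fix e :: real assume "0 < e"
  then have e: "0 < e / 2" by simp
  obtain l where l: "\<And>n. (\<lambda>m. ennreal (d (x n) (y m))) \<longlonglongrightarrow> l n" "l \<longlonglongrightarrow> L"
    using L unfolding has_iterated_limit_def by blast
  obtain r where r: "\<And>n. (\<lambda>m. ennreal (d (x m) (y n))) \<longlonglongrightarrow> r n" "r \<longlonglongrightarrow> R"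
    using R unfolding has_iterated_limit_def by blast
  obtain i where i: "\<And>n m. i \<le> n \<Longrightarrow> n \<le> m \<Longrightarrow> ennreal (d (x n) (x m)) \<le> ennreal (e / 2)"
    using forward_Cauchy_ennreal[OF x e] by blast
  obtain j where j: "\<And>n m. j \<le> n \<Longrightarrow> n \<le> m \<Longrightarrow> ennreal (d (y m) (y n)) \<le> ennreal (e / 2)"
    using forward_Cauchy_ennreal[OF y e] by (auto simp: drev_def)
  note xM = forward_Cauchy_mem[OF x] and yM = forward_Cauchy_mem[OF y]
  have half: "ennreal (e / 2) + ennreal (e / 2) = ennreal e"
    using e by (simp flip: ennreal_plus)
  have "ennreal (d (x n) (y m)) \<le> R + ennreal e" if n: "i \<le> n" and m: "j \<le> m" for n m
  proof -
    have "ennreal (d (x n) (y m)) \<le> ennreal (d (x k) (y h)) + ennreal e"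
      if "n \<le> k" "m \<le> h" for k h
    proof -
      have "ennreal (d (x n) (y m)) \<le> ennreal (d (x n) (x k)) + ennreal (d (x k) (y m))"
        by (rule ennreal_triangle[OF gms xM xM yM])
      also have "\<dots> \<le> ennreal (e / 2) + (ennreal (d (x k) (y h)) + ennreal (e / 2))"
        by (intro add_mono i[OF n that(1)]
            order_trans[OF ennreal_triangle[OF gms xM yM yM] add_left_mono[OF j[OF m that(2)]]])
      also have "\<dots> = ennreal (d (x k) (y h)) + ennreal e"
        unfolding half[symmetric] by (simp add: ac_simps)
      finally show ?thesis .
    qed
    then have "ennreal (d (x n) (y m)) \<le> r h + ennreal e" if "m \<le> h" for h
      using that by (intro LIMSEQ_le_const[OF tendsto_add[OF r(1) tendsto_const]]) blast
    then show ?thesis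
      by (intro LIMSEQ_le_const[OF tendsto_add[OF r(2) tendsto_const]]) blast
  qed
  then have "l n \<le> R + ennreal e" if "i \<le> n" for n
    using that by (intro LIMSEQ_le_const2[OF l(1)]) blast
  then show "L \<le> R + ennreal e"
    by (intro LIMSEQ_le_const2[OF l(2)]) blast
qed

lemma ext_dist_le_drev:
  assumes gms: "generalized_metric_space M d"
    and p: "p \<in> forward_completion M d" and q: "q \<in> backward_completion M d"
  shows "ext_dist d p q \<le> ext_dist (drev d) q p"
proof -
  note gms' = generalized_metric_space_drev[OF gms]
  have q': "q \<in> forward_completion M (drev d)" and p': "p \<in> backward_completion M (drev d)"
    using p q by (simp_all add: backward_completion_def)
  obtain x y where x: "x \<in> p" and y: "y \<in> q"
    using forward_completion_nonempty[OF gms p] forward_completion_nonempty[OF gms' q'] by blast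
  have "has_iterated_limit (\<lambda>n m. d (x n) (y m)) (ext_dist d p q)"
    using is_ext_dist_ext_dist[OF gms p, of q] q x y by (simp add: is_ext_dist_def)
  moreover have "has_iterated_limit (\<lambda>n m. d (x m) (y n)) (ext_dist (drev d) q p)"
    using is_ext_dist_ext_dist[OF gms' q', of p] p' x y
    unfolding is_ext_dist_def drev_def by blast
  ultimately show ?thesis
    using iterated_limit_swap_le[OF gms forward_completion_Cauchy[OF gms p x]
        forward_completion_Cauchy[OF gms' q' y]] by blast
qed

theorem proposition3p32:
  fixes M :: "'a set" and d :: "'a \<Rightarrow> 'a \<Rightarrow> real"
  assumes "generalized_metric_space M d"
  shows "(\<forall>p \<in> forward_completion M d.
            \<forall>q \<in> forward_completion M d \<union> backward_completion M d.
              \<exists>!L. is_ext_dist d p q L)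
       \<and> (\<forall>p \<in> backward_completion M d.
            \<forall>q \<in> forward_completion M d \<union> backward_completion M d.
              \<exists>!L. is_ext_dist (drev d) p q L)
       \<and> (\<forall>p \<in> forward_completion M d. \<forall>q \<in> backward_completion M d.
            ext_dist d p q = ext_dist (drev d) q p)"
proof (intro conjI ballI)
  note gms' = generalized_metric_space_drev[OF assms]
  show "\<exists>!L. is_ext_dist d p q L"
    if "p \<in> forward_completion M d" "q \<in> forward_completion M d \<union> backward_completion M d" for p q
    using ex1_ext_dist[OF assms that] .
  show "\<exists>!L. is_ext_dist (drev d) p q L"
    if "p \<in> backward_completion M d" "q \<in> forward_completion M d \<union> backward_completion M d" for p q
    using ex1_ext_dist[OF gms', of p q] that by (simp add: backward_completion_def disj_commute)
  show "ext_dist d p q = ext_dist (drev d) q p"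
    if "p \<in> forward_completion M d" "q \<in> backward_completion M d" for p q
    using ext_dist_le_drev[OF assms that] ext_dist_le_drev[OF gms', of q p] that
    by (simp add: backward_completion_def)
qed

end
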